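(* Let $G$ be a finite group such that every subgroup of $G$ is isomorphic to a quotient of $G$. Then $G$ is an $\mathrm{NV}_k$-group for every field $k$.
   Context: For finite groups $G,H$, a $G$-$H$-biset is a finite set with commuting left $G$-action and right $H$-action. $B(G,H)$ is the Grothendieck group (for disjoint union) of finite $G$-$H$-bisets and $kB(G,H)=k\otimes_{\mathbb Z}B(G,H)$. For a $G$-$H$-biset $U$ and an $H$-$K$-biset $W$, $U\times_H W$ is the quotient of $U\times W$ by the relation $(uh,w)\sim(u,hw)$; this extends to a bilinear map $kB(G,H)\times kB(H,K)\to kB(G,K)$. The biset category $k\mathcal C$ has the finite groups as objects, $\mathrm{Hom}_{k\mathcal C}(G,H)=kB(H,G)$, composition $\times_H$, and the identity of $G$ is the class of the biset $G$. A subquotient of $G$ is a group $B/A$ with $A\trianglelefteq B\leqslant G$. $\mathcal F_{G,k}$ is the category of $k$-linear functors from the full subcategory of $k\mathcal C$ on all groups isomorphic to subquotients of $G$ to $k\text{-}\mathrm{Mod}$. $G$ is an $\mathrm{NV}_k$-group (non-vanishing over $k$) if $S(G)\neq0$ for every simple object $S$ of $\mathcal F_{G,k}$. *)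

theory Defs
  imports "HOL-Algebra.Free_Abelian_Groups" "HOL-Algebra.Module"
begin

section \<open>Bisets\<close>

record ('g, 'h, 'u) biset =
  points :: "'u set"
  lact :: "'g \<Rightarrow> 'u \<Rightarrow> 'u"
  ract :: "'u \<Rightarrow> 'h \<Rightarrow> 'u"

locale biset = G: group G + H: group H
  for G :: "'g monoid" and H :: "'h monoid" and U :: "('g, 'h, 'u) biset" +
  assumes finite_points: "finite (points U)"
    and lact_closed: "\<lbrakk>g \<in> carrier G; u \<in> points U\<rbrakk> \<Longrightarrow> lact U g u \<in> points U"
    and lact_one: "u \<in> points U \<Longrightarrow> lact U \<one>\<^bsub>G\<^esub> u = u"
    and lact_mult: "\<lbrakk>g \<in> carrier G; g' \<in> carrier G; u \<in> points U\<rbrakk>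
      \<Longrightarrow> lact U (g \<otimes>\<^bsub>G\<^esub> g') u = lact U g (lact U g' u)"
    and ract_closed: "\<lbrakk>u \<in> points U; h \<in> carrier H\<rbrakk> \<Longrightarrow> ract U u h \<in> points U"
    and ract_one: "u \<in> points U \<Longrightarrow> ract U u \<one>\<^bsub>H\<^esub> = u"
    and ract_mult: "\<lbrakk>u \<in> points U; h \<in> carrier H; h' \<in> carrier H\<rbrakk>
      \<Longrightarrow> ract U u (h \<otimes>\<^bsub>H\<^esub> h') = ract U (ract U u h) h'"
    and commuting: "\<lbrakk>g \<in> carrier G; u \<in> points U; h \<in> carrier H\<rbrakk>
      \<Longrightarrow> ract U (lact U g u) h = lact U g (ract U u h)"

definition biset_iso ::
    "'g monoid \<Rightarrow> 'h monoid \<Rightarrow> ('g, 'h, 'u) biset \<Rightarrow> ('g, 'h, 'v) biset \<Rightarrow> bool" where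
  "biset_iso G H U V \<longleftrightarrow> (\<exists>f. bij_betw f (points U) (points V) \<and>
     (\<forall>g\<in>carrier G. \<forall>u\<in>points U. f (lact U g u) = lact V g (f u)) \<and>
     (\<forall>u\<in>points U. \<forall>h\<in>carrier H. f (ract U u h) = ract V (f u) h))"

definition disjoint_union ::
    "('g, 'h, 'u) biset \<Rightarrow> ('g, 'h, 'v) biset \<Rightarrow> ('g, 'h, 'u + 'v) biset" where
  "disjoint_union U V =
     \<lparr>points = points U <+> points V,
      lact = (\<lambda>g. map_sum (lact U g) (lact V g)),
      ract = (\<lambda>x h. map_sum (\<lambda>u. ract U u h) (\<lambda>v. ract V v h) x)\<rparr>"

text \<open>The set of pairs below is already an equivalence relation on the product: \<open>(u', w)\<close> and
  \<open>(u, w')\<close> are related iff they lie in one orbit of \<open>h \<cdot> (u, w) = (u h\<inverse>, h w)\<close>.\<close>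

definition tensor_rel ::
    "'h monoid \<Rightarrow> ('g, 'h, 'u) biset \<Rightarrow> ('h, 'l, 'w) biset \<Rightarrow> (('u \<times> 'w) \<times> ('u \<times> 'w)) set" where
  "tensor_rel H U W =
     {((ract U u h, w), (u, lact W h w)) | u h w.
        u \<in> points U \<and> h \<in> carrier H \<and> w \<in> points W}"

definition biset_prod ::
    "'h monoid \<Rightarrow> ('g, 'h, 'u) biset \<Rightarrow> ('h, 'l, 'w) biset \<Rightarrow> ('g, 'l, ('u \<times> 'w) set) biset" where
  "biset_prod H U W =
     \<lparr>points = (points U \<times> points W) // tensor_rel H U W,
      lact = (\<lambda>g c. (\<lambda>(u, w). (lact U g u, w)) ` c),
      ract = (\<lambda>c l. (\<lambda>(u, w). (u, ract W w l)) ` c)\<rparr>"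

definition regular_biset :: "'g monoid \<Rightarrow> ('g, 'g, 'g) biset" where
  "regular_biset G = \<lparr>points = carrier G, lact = (\<otimes>\<^bsub>G\<^esub>), ract = (\<otimes>\<^bsub>G\<^esub>)\<rparr>"

text \<open>Every finite biset has a copy whose points are natural numbers, so isomorphism classes of
  finite bisets are represented by the classes of such copies.\<close>

type_synonym ('g, 'h) biset_class = "('g, 'h, nat) biset set"

definition biset_class ::
    "'g monoid \<Rightarrow> 'h monoid \<Rightarrow> ('g, 'h, 'u) biset \<Rightarrow> ('g, 'h) biset_class" where
  "biset_class G H U = {X. biset G H X \<and> biset_iso G H X U}"

definition biset_classes :: "'g monoid \<Rightarrow> 'h monoid \<Rightarrow> ('g, 'h) biset_class set" where
  "biset_classes G H = {biset_class G H U | U :: ('g, 'h, nat) biset. biset G H U}"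

definition class_prod ::
    "'g monoid \<Rightarrow> 'h monoid \<Rightarrow> 'l monoid \<Rightarrow>
     ('g, 'h) biset_class \<Rightarrow> ('h, 'l) biset_class \<Rightarrow> ('g, 'l) biset_class" where
  "class_prod G H L p q = (\<Union>U\<in>p. \<Union>W\<in>q. biset_class G L (biset_prod H U W))"


section \<open>Abelian groups given by generators and relations\<close>

definition relators :: "'x set \<Rightarrow> ('x \<Rightarrow>\<^sub>0 int) set \<Rightarrow> ('x \<Rightarrow>\<^sub>0 int) set" where
  "relators S R = generate (free_Abelian_group S) R"

definition presented_group :: "'x set \<Rightarrow> ('x \<Rightarrow>\<^sub>0 int) set \<Rightarrow> ('x \<Rightarrow>\<^sub>0 int) set monoid" where
  "presented_group S R = free_Abelian_group S Mod relators S R"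

definition presented_class ::
    "'x set \<Rightarrow> ('x \<Rightarrow>\<^sub>0 int) set \<Rightarrow> ('x \<Rightarrow>\<^sub>0 int) \<Rightarrow> ('x \<Rightarrow>\<^sub>0 int) set" where
  "presented_class S R x = relators S R #>\<^bsub>free_Abelian_group S\<^esub> x"

definition frag_extend2 ::
    "('a \<Rightarrow> 'b \<Rightarrow> ('c \<Rightarrow>\<^sub>0 int)) \<Rightarrow> ('a \<Rightarrow>\<^sub>0 int) \<Rightarrow> ('b \<Rightarrow>\<^sub>0 int) \<Rightarrow> ('c \<Rightarrow>\<^sub>0 int)" where
  "frag_extend2 f x y = frag_extend (\<lambda>a. frag_extend (f a) y) x"

text \<open>For abelian groups \<open>A\<close> and \<open>B\<close> (written multiplicatively), \<open>A \<otimes>\<^sub>\<int> B\<close> is generated by the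
  symbols \<open>(a, b)\<close> subject to additivity in each argument.\<close>

definition tensor_relations ::
    "('a, 'm) monoid_scheme \<Rightarrow> ('b, 'n) monoid_scheme \<Rightarrow> ('a \<times> 'b \<Rightarrow>\<^sub>0 int) set" where
  "tensor_relations A B =
     {frag_of (a \<otimes>\<^bsub>A\<^esub> a', b) - frag_of (a, b) - frag_of (a', b) | a a' b.
        a \<in> carrier A \<and> a' \<in> carrier A \<and> b \<in> carrier B} \<union>
     {frag_of (a, b \<otimes>\<^bsub>B\<^esub> b') - frag_of (a, b) - frag_of (a, b') | a b b'.
        a \<in> carrier A \<and> b \<in> carrier B \<and> b' \<in> carrier B}"

definition tensor_group ::
    "('a, 'm) monoid_scheme \<Rightarrow> ('b, 'n) monoid_scheme \<Rightarrow> ('a \<times> 'b \<Rightarrow>\<^sub>0 int) set monoid" where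
  "tensor_group A B = presented_group (carrier A \<times> carrier B) (tensor_relations A B)"

definition tensor_class ::
    "('a, 'm) monoid_scheme \<Rightarrow> ('b, 'n) monoid_scheme \<Rightarrow>
     ('a \<times> 'b \<Rightarrow>\<^sub>0 int) \<Rightarrow> ('a \<times> 'b \<Rightarrow>\<^sub>0 int) set" where
  "tensor_class A B = presented_class (carrier A \<times> carrier B) (tensor_relations A B)"

text \<open>Extension of scalars \<open>K \<otimes>\<^sub>\<int> B\<close> of an abelian group \<open>B\<close>, with \<open>c (a \<otimes> b) = (c a) \<otimes> b\<close>.
  The fields \<open>mult\<close> and \<open>one\<close> of the record play no role for modules.\<close>

definition scalar_extension ::
    "'k ring \<Rightarrow> 'b monoid \<Rightarrow> ('k, ('k \<times> 'b \<Rightarrow>\<^sub>0 int) set) module" where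
  "scalar_extension K B =
     \<lparr>carrier = carrier (tensor_group (add_monoid K) B),
      monoid.mult = undefined, one = undefined,
      zero = one (tensor_group (add_monoid K) B),
      add = monoid.mult (tensor_group (add_monoid K) B),
      smult = (\<lambda>c X. \<Union>x\<in>X. tensor_class (add_monoid K) B
                        (frag_extend (\<lambda>(a, b). frag_of (c \<otimes>\<^bsub>K\<^esub> a, b)) x))\<rparr>"


section \<open>The biset category\<close>

type_synonym ('g, 'h) burnside = "(('g, 'h) biset_class \<Rightarrow>\<^sub>0 int) set"

definition burnside_relations ::
    "'g monoid \<Rightarrow> 'h monoid \<Rightarrow> (('g, 'h) biset_class \<Rightarrow>\<^sub>0 int) set" where
  "burnside_relations G H =
     {frag_of (biset_class G H (disjoint_union U V))
        - frag_of (biset_class G H U) - frag_of (biset_class G H V)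
      | (U :: ('g, 'h, nat) biset) (V :: ('g, 'h, nat) biset). biset G H U \<and> biset G H V}"

definition burnside_group :: "'g monoid \<Rightarrow> 'h monoid \<Rightarrow> ('g, 'h) burnside monoid" where
  "burnside_group G H = presented_group (biset_classes G H) (burnside_relations G H)"

definition burnside_class ::
    "'g monoid \<Rightarrow> 'h monoid \<Rightarrow> (('g, 'h) biset_class \<Rightarrow>\<^sub>0 int) \<Rightarrow> ('g, 'h) burnside" where
  "burnside_class G H = presented_class (biset_classes G H) (burnside_relations G H)"

text \<open>The bilinear extensions of \<open>\<times>\<^sub>H\<close> to \<open>B(G,H) \<times> B(H,L)\<close> and to
  \<open>K B(G,H) \<times> K B(H,L)\<close>. They are computed on representatives: the class of the result does not
  depend on \<open>x\<close> and \<open>y\<close>, so that the unions below are unions of one and the same coset.\<close>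

definition burnside_prod ::
    "'g monoid \<Rightarrow> 'h monoid \<Rightarrow> 'l monoid \<Rightarrow>
     ('g, 'h) burnside \<Rightarrow> ('h, 'l) burnside \<Rightarrow> ('g, 'l) burnside" where
  "burnside_prod G H L X Y = (\<Union>x\<in>X. \<Union>y\<in>Y.
     burnside_class G L (frag_extend2 (\<lambda>p q. frag_of (class_prod G H L p q)) x y))"

type_synonym ('k, 'g, 'h) kburnside = "('k \<times> ('g, 'h) burnside \<Rightarrow>\<^sub>0 int) set"

definition kburnside ::
    "'k ring \<Rightarrow> 'g monoid \<Rightarrow> 'h monoid \<Rightarrow> ('k, ('k, 'g, 'h) kburnside) module" where
  "kburnside K G H = scalar_extension K (burnside_group G H)"

definition kburnside_prod ::
    "'k ring \<Rightarrow> 'g monoid \<Rightarrow> 'h monoid \<Rightarrow> 'l monoid \<Rightarrow>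
     ('k, 'g, 'h) kburnside \<Rightarrow> ('k, 'h, 'l) kburnside \<Rightarrow> ('k, 'g, 'l) kburnside" where
  "kburnside_prod K G H L X Y = (\<Union>x\<in>X. \<Union>y\<in>Y.
     tensor_class (add_monoid K) (burnside_group G L)
       (frag_extend2 (\<lambda>(a, b) (a', b'). frag_of (a \<otimes>\<^bsub>K\<^esub> a', burnside_prod G H L b b')) x y))"

definition kbiset ::
    "'k ring \<Rightarrow> 'g monoid \<Rightarrow> 'h monoid \<Rightarrow> ('g, 'h, 'u) biset \<Rightarrow> ('k, 'g, 'h) kburnside" where
  "kbiset K G H U = tensor_class (add_monoid K) (burnside_group G H)
     (frag_of (\<one>\<^bsub>K\<^esub>, burnside_class G H (frag_of (biset_class G H U))))"

definition bc_hom ::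
    "'k ring \<Rightarrow> 'g monoid \<Rightarrow> 'h monoid \<Rightarrow> ('k, ('k, 'h, 'g) kburnside) module" where
  "bc_hom K G H = kburnside K H G"

text \<open>\<open>bc_comp K G H L y x\<close> is \<open>y \<circ> x\<close> for \<open>x : G \<rightarrow> H\<close> and \<open>y : H \<rightarrow> L\<close>.\<close>

definition bc_comp ::
    "'k ring \<Rightarrow> 'g monoid \<Rightarrow> 'h monoid \<Rightarrow> 'l monoid \<Rightarrow>
     ('k, 'l, 'h) kburnside \<Rightarrow> ('k, 'h, 'g) kburnside \<Rightarrow> ('k, 'l, 'g) kburnside" where
  "bc_comp K G H L y x = kburnside_prod K L H G y x"

definition bc_id :: "'k ring \<Rightarrow> 'g monoid \<Rightarrow> ('k, 'g, 'g) kburnside" where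
  "bc_id K G = kbiset K G G (regular_biset G)"


section \<open>Biset functors on the subquotients of a group\<close>

text \<open>The groups isomorphic to a subquotient of \<open>G\<close> are taken with elements in the type of \<open>G\<close>.
  No isomorphism class is lost, as a subquotient of \<open>G\<close> has a copy on a set of representatives of
  its cosets.\<close>

definition subquotients :: "'g monoid \<Rightarrow> 'g monoid set" where
  "subquotients G = {H. group H \<and> finite (carrier H) \<and>
     (\<exists>B A. subgroup B G \<and> A \<lhd> (G\<lparr>carrier := B\<rparr>) \<and> H \<cong> (G\<lparr>carrier := B\<rparr>) Mod A)}"

record ('k, 'g, 'v) biset_functor =
  obj_map :: "'g monoid \<Rightarrow> ('k, 'v) module"
  mor_map :: "'g monoid \<Rightarrow> 'g monoid \<Rightarrow> ('k, 'g, 'g) kburnside \<Rightarrow> 'v \<Rightarrow> 'v"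

locale biset_functor =
  fixes K :: "'k ring" and G :: "'g monoid" and F :: "('k, 'g, 'v) biset_functor"
  assumes obj_module: "H \<in> subquotients G \<Longrightarrow> module K (obj_map F H)"
    and mor_closed: "\<lbrakk>H \<in> subquotients G; L \<in> subquotients G; x \<in> carrier (bc_hom K H L);
        v \<in> carrier (obj_map F H)\<rbrakk>
      \<Longrightarrow> mor_map F H L x v \<in> carrier (obj_map F L)"
    and mor_add: "\<lbrakk>H \<in> subquotients G; L \<in> subquotients G; x \<in> carrier (bc_hom K H L);
        v \<in> carrier (obj_map F H); w \<in> carrier (obj_map F H)\<rbrakk>
      \<Longrightarrow> mor_map F H L x (v \<oplus>\<^bsub>obj_map F H\<^esub> w)
          = mor_map F H L x v \<oplus>\<^bsub>obj_map F L\<^esub> mor_map F H L x w"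
    and mor_smult: "\<lbrakk>H \<in> subquotients G; L \<in> subquotients G; x \<in> carrier (bc_hom K H L);
        v \<in> carrier (obj_map F H); c \<in> carrier K\<rbrakk>
      \<Longrightarrow> mor_map F H L x (c \<odot>\<^bsub>obj_map F H\<^esub> v) = c \<odot>\<^bsub>obj_map F L\<^esub> mor_map F H L x v"
    and functor_add: "\<lbrakk>H \<in> subquotients G; L \<in> subquotients G; x \<in> carrier (bc_hom K H L);
        y \<in> carrier (bc_hom K H L); v \<in> carrier (obj_map F H)\<rbrakk>
      \<Longrightarrow> mor_map F H L (x \<oplus>\<^bsub>bc_hom K H L\<^esub> y) v
          = mor_map F H L x v \<oplus>\<^bsub>obj_map F L\<^esub> mor_map F H L y v"
    and functor_smult: "\<lbrakk>H \<in> subquotients G; L \<in> subquotients G; x \<in> carrier (bc_hom K H L);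
        c \<in> carrier K; v \<in> carrier (obj_map F H)\<rbrakk>
      \<Longrightarrow> mor_map F H L (c \<odot>\<^bsub>bc_hom K H L\<^esub> x) v = c \<odot>\<^bsub>obj_map F L\<^esub> mor_map F H L x v"
    and functor_id: "\<lbrakk>H \<in> subquotients G; v \<in> carrier (obj_map F H)\<rbrakk>
      \<Longrightarrow> mor_map F H H (bc_id K H) v = v"
    and functor_comp: "\<lbrakk>H \<in> subquotients G; L \<in> subquotients G; M \<in> subquotients G;
        x \<in> carrier (bc_hom K H L); y \<in> carrier (bc_hom K L M); v \<in> carrier (obj_map F H)\<rbrakk>
      \<Longrightarrow> mor_map F H M (bc_comp K H L M y x) v = mor_map F L M y (mor_map F H L x v)"

definition subfunctor ::
    "'k ring \<Rightarrow> 'g monoid \<Rightarrow> ('k, 'g, 'v) biset_functor \<Rightarrow> ('g monoid \<Rightarrow> 'v set) \<Rightarrow> bool" where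
  "subfunctor K G F T \<longleftrightarrow>
     (\<forall>H\<in>subquotients G. submodule (T H) K (obj_map F H)) \<and>
     (\<forall>H\<in>subquotients G. \<forall>L\<in>subquotients G. \<forall>x\<in>carrier (bc_hom K H L).
        mor_map F H L x ` T H \<subseteq> T L)"

definition simple_functor :: "'k ring \<Rightarrow> 'g monoid \<Rightarrow> ('k, 'g, 'v) biset_functor \<Rightarrow> bool" where
  "simple_functor K G F \<longleftrightarrow> biset_functor K G F \<and>
     (\<exists>H\<in>subquotients G. carrier (obj_map F H) \<noteq> {\<zero>\<^bsub>obj_map F H\<^esub>}) \<and>
     (\<forall>T. subfunctor K G F T \<longrightarrow>
        (\<forall>H\<in>subquotients G. T H = {\<zero>\<^bsub>obj_map F H\<^esub>}) \<or>
        (\<forall>H\<in>subquotients G. T H = carrier (obj_map F H)))"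

text \<open>A definition in HOL cannot quantify over types, so the type \<open>'v\<close> in which the modules
  \<open>S(H)\<close> live is a parameter; as a free type variable of a theorem it is universally
  quantified there.\<close>

definition NV_group :: "'v itself \<Rightarrow> 'k ring \<Rightarrow> 'g monoid \<Rightarrow> bool" where
  "NV_group _ K G \<longleftrightarrow> (\<forall>S :: ('k, 'g, 'v) biset_functor.
     simple_functor K G S \<longrightarrow> carrier (obj_map S G) \<noteq> {\<zero>\<^bsub>obj_map S G\<^esub>})"

end

theory Submission
  imports Defs
begin

text \<open>If \<open>S(H) \<noteq> 0\<close> for a subquotient \<open>H = B/A\<close> of \<open>G\<close>, then \<open>H\<close> is a quotient of \<open>B\<close> and
  \<open>B\<close> is a quotient of \<open>G\<close>, so there is an epimorphism \<open>\<pi> : G \<rightarrow> H\<close>. Let \<open>G\<close> act on the set \<open>H\<close>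
  through \<open>\<pi>\<close>; this gives the inflation biset (a \<open>G\<close>-\<open>H\<close>-biset) and the deflation biset (an
  \<open>H\<close>-\<open>G\<close>-biset), and deflation \<open>\<times>\<^sub>G\<close> inflation is isomorphic to the regular biset \<open>H\<close>. Hence the
  identity of \<open>S(H)\<close> factors through \<open>S(G)\<close>, which therefore cannot vanish.

  Composition of representatives is well defined because a bilinear map on generators descends to
  presented groups as soon as it sends each relation, paired with a generator, to a relator.\<close>

section \<open>Bilinear maps on generators\<close>

text \<open>Products of cosets are defined as unions over all pairs of representatives. This
  evaluates such a union once independence of the representatives is known; the index sets have to
  be inhabited, since an empty union is empty.\<close>

lemma UN2_constant:
  assumes "X \<noteq> {}" and "Y \<noteq> {}" and "\<And>x y. \<lbrakk>x \<in> X; y \<in> Y\<rbrakk> \<Longrightarrow> f x y = c"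
  shows "(\<Union>x\<in>X. \<Union>y\<in>Y. f x y) = c"
  using assms by simp

lemma frag_extend2_add1: "frag_extend2 f (x + x') y = frag_extend2 f x y + frag_extend2 f x' y"
  by (simp add: frag_extend2_def frag_extend_add)

lemma frag_extend2_diff1: "frag_extend2 f (x - x') y = frag_extend2 f x y - frag_extend2 f x' y"
  by (simp add: frag_extend2_def frag_extend_diff)

lemma frag_extend2_minus1: "frag_extend2 f (- x) y = - frag_extend2 f x y"
  by (simp add: frag_extend2_def frag_extend_minus)

text \<open>Linearity in the function rather than in the argument; this is what makes
  \<open>frag_extend2\<close> additive in its second argument.\<close>

lemma frag_extend_pointwise_diff:
  "frag_extend (\<lambda>a. g a - h a) x = frag_extend g x - frag_extend h x"
proof -
  have "Poly_Mapping.keys x \<subseteq> UNIV" by simp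
  then show ?thesis
    by (induction x rule: frag_induction) (auto simp: frag_extend_diff)
qed

text \<open>Both sides are additive in \<open>x\<close> and agree on generators. The symmetry
  transfers each rule for the first argument to the second.\<close>

lemma frag_extend2_swap: "frag_extend2 f x y = frag_extend2 (\<lambda>b a. f a b) y x"
proof -
  have "Poly_Mapping.keys x \<subseteq> UNIV" by simp
  then show ?thesis
  proof (induction x rule: frag_induction)
    case (diff x x')
    then show ?case
      by (simp add: frag_extend2_def frag_extend_diff frag_extend_pointwise_diff)
  qed (simp_all add: frag_extend2_def, simp add: frag_extend_def)
qed

lemma frag_extend2_add2: "frag_extend2 f x (y + y') = frag_extend2 f x y + frag_extend2 f x y'"
  by (simp add: frag_extend2_swap[of f] frag_extend2_add1)

lemma frag_extend2_diff2: "frag_extend2 f x (y - y') = frag_extend2 f x y - frag_extend2 f x y'"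
  by (simp add: frag_extend2_swap[of f] frag_extend2_diff1)

lemma frag_extend2_zero [simp]: "frag_extend2 f 0 y = 0" "frag_extend2 f x 0 = 0"
  by (simp_all add: frag_extend2_swap[of f x]) (simp_all add: frag_extend2_def)

lemma frag_extend2_of [simp]: "frag_extend2 f (frag_of a) (frag_of b) = f a b"
  by (simp add: frag_extend2_def)

text \<open>Membership in a free abelian group is a condition on the support, so this is closure
  under a bilinear extension.\<close>

lemma keys_frag_extend2:
  assumes "\<And>a b. \<lbrakk>a \<in> S; b \<in> T\<rbrakk> \<Longrightarrow> Poly_Mapping.keys (f a b) \<subseteq> V"
    and "Poly_Mapping.keys x \<subseteq> S" and "Poly_Mapping.keys y \<subseteq> T"
  shows "Poly_Mapping.keys (frag_extend2 f x y) \<subseteq> V"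
proof -
  have "Poly_Mapping.keys (frag_extend (f a) y) \<subseteq> V" if "a \<in> S" for a
    using keys_frag_extend[of "f a" y] assms(1)[OF that] assms(3) by blast
  then show ?thesis
    unfolding frag_extend2_def
    using keys_frag_extend[of "\<lambda>a. frag_extend (f a) y" x] assms(2) by blast
qed

section \<open>Presented abelian groups\<close>

lemma zero_in_relators: "0 \<in> relators S R"
  unfolding relators_def using generate.one[of "free_Abelian_group S" R] by simp

lemma relators_add: "\<lbrakk>x \<in> relators S R; y \<in> relators S R\<rbrakk> \<Longrightarrow> x + y \<in> relators S R"
  unfolding relators_def using generate.eng[of x "free_Abelian_group S" R y] by simp

lemma relators_incl: "x \<in> R \<Longrightarrow> x \<in> relators S R"
  unfolding relators_def by (rule generate.incl)

lemma presented_class_eq: "presented_class S R x = {r + x | r. r \<in> relators S R}"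
  unfolding presented_class_def r_coset_def by auto

lemma presented_class_self: "x \<in> presented_class S R x"
  unfolding presented_class_eq using zero_in_relators by force

text \<open>The relations have to lie in the free group on \<open>S\<close> for
  \<open>generate\<close> to yield a subgroup, and hence for the relators to be closed under
  negation.\<close>

locale presentation =
  fixes S :: "'x set" and R :: "('x \<Rightarrow>\<^sub>0 int) set"
  assumes relations_closed: "R \<subseteq> carrier (free_Abelian_group S)"
begin

lemma subgroup_relators: "subgroup (relators S R) (free_Abelian_group S)"
  unfolding relators_def
  by (rule group.generate_is_subgroup[OF group_free_Abelian_group relations_closed])

lemma relators_keys: "x \<in> relators S R \<Longrightarrow> Poly_Mapping.keys x \<subseteq> S"
  using subgroup.mem_carrier[OF subgroup_relators] by simp

lemma relators_minus: "x \<in> relators S R \<Longrightarrow> - x \<in> relators S R"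
  using subgroup.m_inv_closed[OF subgroup_relators] relators_keys by fastforce

lemma relators_diff: "\<lbrakk>x \<in> relators S R; y \<in> relators S R\<rbrakk> \<Longrightarrow> x - y \<in> relators S R"
  using relators_add relators_minus by (metis add_uminus_conv_diff)

text \<open>The rule for \<open>generate\<close> speaks of the group operation and the group
  inverse. On the carrier the inverse is negation, so induction can be phrased with \<open>+\<close>
  and \<open>-\<close>, through which additive maps pass.\<close>

lemma relators_induct [consumes 1, case_names zero incl add minus]:
  assumes "x \<in> relators S R" and "P 0" and "\<And>r. r \<in> R \<Longrightarrow> P r"
    and "\<And>x y. \<lbrakk>P x; P y\<rbrakk> \<Longrightarrow> P (x + y)" and "\<And>x. P x \<Longrightarrow> P (- x)"
  shows "P x"
proof -
  have "x \<in> generate (free_Abelian_group S) R"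
    using assms(1) by (simp only: relators_def)
  then show ?thesis
  proof (induction rule: generate.induct)
    case one
    show ?case using assms(2) by simp
  next
    case (incl h)
    then show ?case by (rule assms(3))
  next
    case (inv h)
    then have "h \<in> carrier (free_Abelian_group S)" using relations_closed by (rule subsetD[rotated])
    then have "inv\<^bsub>free_Abelian_group S\<^esub> h = - h" by simp
    moreover have "P (- h)" by (rule assms(5)[OF assms(3)[OF inv]])
    ultimately show ?case by simp
  next
    case (eng h1 h2)
    show ?case using assms(4)[OF eng.IH] by simp
  qed
qed

lemma presented_class_eq_iff:
  "presented_class S R x = presented_class S R y \<longleftrightarrow> x - y \<in> relators S R"
proof
  assume "presented_class S R x = presented_class S R y"
  then have "x \<in> presented_class S R y" using presented_class_self by metis
  then show "x - y \<in> relators S R" by (auto simp: presented_class_eq)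
next
  assume d: "x - y \<in> relators S R"
  \<comment> \<open>These identities exchange the base points \<open>x\<close> and \<open>y\<close>;
    the relator part absorbs \<open>x - y\<close>.\<close>
  have "r + x = (r + (x - y)) + y" "r + y = (r - (x - y)) + x" for r by simp_all
  then show "presented_class S R x = presented_class S R y"
    unfolding presented_class_eq using d relators_add relators_diff by blast
qed

lemma carrier_presented_group:
  "carrier (presented_group S R) = presented_class S R ` carrier (free_Abelian_group S)"
  unfolding presented_group_def presented_class_def carrier_FactGroup by simp

lemma presented_class_closed:
  "Poly_Mapping.keys x \<subseteq> S \<Longrightarrow> presented_class S R x \<in> carrier (presented_group S R)"
  unfolding carrier_presented_group by simp

text \<open>The operation of a factor group is the product of cosets as sets. Commutativity collects
  the two relators into one; conversely a relator \<open>r\<close> is split as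
  \<open>r + 0\<close>.\<close>

lemma mult_presented_group:
  "presented_class S R x \<otimes>\<^bsub>presented_group S R\<^esub> presented_class S R y = presented_class S R (x + y)"
proof -
  have "set_mult (free_Abelian_group S) (presented_class S R x) (presented_class S R y)
      = {r + x + (s + y) | r s. r \<in> relators S R \<and> s \<in> relators S R}"
    unfolding set_mult_def presented_class_eq by auto
  also have "\<dots> = presented_class S R (x + y)"
    unfolding presented_class_eq
  proof (intro equalityI subsetI; clarify)
    fix r s assume "r \<in> relators S R" "s \<in> relators S R"
    then show "\<exists>ra. r + x + (s + y) = ra + (x + y) \<and> ra \<in> relators S R"
      by (intro exI[of _ "r + s"]) (simp add: relators_add)
  next
    fix r assume "r \<in> relators S R"
    then show "\<exists>ra s. r + (x + y) = ra + x + (s + y) \<and> ra \<in> relators S R \<and> s \<in> relators S R"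
      by (intro exI[of _ r] exI[of _ 0]) (simp add: zero_in_relators add.assoc)
  qed
  finally show ?thesis unfolding presented_group_def by simp
qed

end

section \<open>Descent of bilinear maps to presented groups\<close>

locale presented_bilinear =
  S1: presentation S1 R1 + S2: presentation S2 R2 + S3: presentation S3 R3
  for S1 :: "'x set" and R1 :: "('x \<Rightarrow>\<^sub>0 int) set"
    and S2 :: "'y set" and R2 :: "('y \<Rightarrow>\<^sub>0 int) set"
    and S3 :: "'z set" and R3 :: "('z \<Rightarrow>\<^sub>0 int) set" +
  fixes f :: "'x \<Rightarrow> 'y \<Rightarrow> ('z \<Rightarrow>\<^sub>0 int)"
  assumes relations1:
      "\<lbrakk>r \<in> R1; t \<in> S2\<rbrakk> \<Longrightarrow> frag_extend2 f r (frag_of t) \<in> relators S3 R3"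
    and relations2:
      "\<lbrakk>s \<in> S1; q \<in> R2\<rbrakk> \<Longrightarrow> frag_extend2 f (frag_of s) q \<in> relators S3 R3"
begin

text \<open>Induction on the relator leaves a single relation in the first argument; induction on
  \<open>y\<close> then leaves a single generator in the second, which is the locale
  assumption.\<close>

lemma relators1:
  assumes r: "r \<in> relators S1 R1" and y: "Poly_Mapping.keys y \<subseteq> S2"
  shows "frag_extend2 f r y \<in> relators S3 R3"
  using r
proof (induction rule: S1.relators_induct)
  case (incl r)
  show ?case using y
    by (induction y rule: frag_induction)
      (simp_all add: zero_in_relators relations1 incl frag_extend2_diff2 S3.relators_diff)
qed (simp_all add: zero_in_relators frag_extend2_add1 relators_add frag_extend2_minus1
    S3.relators_minus)

lemma relators2:
  assumes x: "Poly_Mapping.keys x \<subseteq> S1" and r: "r \<in> relators S2 R2"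
  shows "frag_extend2 f x r \<in> relators S3 R3"
  using r
proof (induction rule: S2.relators_induct)
  case (incl r)
  show ?case using x
    by (induction x rule: frag_induction)
      (simp_all add: zero_in_relators relations2 incl frag_extend2_diff1 S3.relators_diff)
next
  case (minus r)
  \<comment> \<open>Negation in the second argument is read off from the difference
    \<open>0 - r\<close>.\<close>
  then show ?case
    using S3.relators_minus frag_extend2_diff2[of f x 0 r] by simp
qed (simp_all add: zero_in_relators frag_extend2_add2 relators_add)

text \<open>Changing either representative by a relator changes the value by a relator. This is what
  makes the products on Burnside groups, before and after extension of scalars, well
  defined.\<close>

lemma presented_class_frag_extend2:
  assumes x: "Poly_Mapping.keys x \<subseteq> S1" and y: "Poly_Mapping.keys y \<subseteq> S2"
  shows "(\<Union>x'\<in>presented_class S1 R1 x. \<Union>y'\<in>presented_class S2 R2 y.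
            presented_class S3 R3 (frag_extend2 f x' y'))
       = presented_class S3 R3 (frag_extend2 f x y)"
proof -
  have "presented_class S3 R3 (frag_extend2 f x' y') = presented_class S3 R3 (frag_extend2 f x y)"
    if x': "x' \<in> presented_class S1 R1 x" and y': "y' \<in> presented_class S2 R2 y" for x' y'
  proof -
    obtain r where r: "r \<in> relators S1 R1" "x' = r + x" using x' by (auto simp: presented_class_eq)
    obtain s where s: "s \<in> relators S2 R2" "y' = s + y" using y' by (auto simp: presented_class_eq)
    \<comment> \<open>\<open>relators1\<close> will be applied with the changed representative
      \<open>y'\<close>, whose support must therefore lie in \<open>S2\<close> too.\<close>
    have ky': "Poly_Mapping.keys y' \<subseteq> S2"
      using keys_add[of s y] S2.relators_keys[OF s(1)] y s(2) by blast
    \<comment> \<open>The difference is split at the intermediate value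
      \<open>frag_extend2 f x y'\<close>, so that only one argument changes at a time.\<close>
    have "frag_extend2 f x' y' - frag_extend2 f x y = frag_extend2 f r y' + frag_extend2 f x s"
      by (simp add: r(2) s(2) frag_extend2_add1 frag_extend2_add2)
    moreover have "\<dots> \<in> relators S3 R3"
      by (intro relators_add relators1 relators2 r s x ky')
    ultimately show ?thesis by (simp add: S3.presented_class_eq_iff)
  qed
  moreover have "presented_class S1 R1 x \<noteq> {}" "presented_class S2 R2 y \<noteq> {}"
    using presented_class_self by (metis empty_iff)+
  ultimately show ?thesis by (intro UN2_constant)
qed

end

section \<open>Isomorphisms of bisets\<close>

text \<open>That \<open>U\<close> is a biset ensures that translates of its points stay in
  \<open>points U\<close>, where \<open>inv_into\<close> cancels \<open>f\<close>.\<close>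

lemma biset_iso_sym:
  assumes "biset G H U" and "biset_iso G H U V"
  shows "biset_iso G H V U"
proof -
  interpret biset G H U by fact
  obtain f where f: "bij_betw f (points U) (points V)"
    and l: "\<And>g u. \<lbrakk>g \<in> carrier G; u \<in> points U\<rbrakk> \<Longrightarrow> f (lact U g u) = lact V g (f u)"
    and r: "\<And>u h. \<lbrakk>u \<in> points U; h \<in> carrier H\<rbrakk> \<Longrightarrow> f (ract U u h) = ract V (f u) h"
    using assms(2) unfolding biset_iso_def by blast
  let ?k = "inv_into (points U) f"
  have kf: "?k (f u) = u" if "u \<in> points U" for u
    using bij_betw_inv_into_left[OF f that] .
  have V: "\<exists>u\<in>points U. v = f u" if "v \<in> points V" for v
    using f that by (auto simp: bij_betw_def)
  have "?k (lact V g v) = lact U g (?k v)" if "g \<in> carrier G" "v \<in> points V" for g v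
    using V[OF that(2)] that(1) by (auto simp flip: l simp: kf lact_closed)
  moreover have "?k (ract V v h) = ract U (?k v) h" if "v \<in> points V" "h \<in> carrier H" for v h
    using V[OF that(1)] that(2) by (auto simp flip: r simp: kf ract_closed)
  ultimately show ?thesis
    unfolding biset_iso_def using bij_betw_inv_into[OF f] by blast
qed

lemma biset_iso_trans:
  assumes "biset_iso G H U V" and "biset_iso G H V W"
  shows "biset_iso G H U W"
proof -
  obtain f where f: "bij_betw f (points U) (points V)"
    "\<And>g u. \<lbrakk>g \<in> carrier G; u \<in> points U\<rbrakk> \<Longrightarrow> f (lact U g u) = lact V g (f u)"
    "\<And>u h. \<lbrakk>u \<in> points U; h \<in> carrier H\<rbrakk> \<Longrightarrow> f (ract U u h) = ract V (f u) h"
    using assms(1) unfolding biset_iso_def by blast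
  obtain k where k: "bij_betw k (points V) (points W)"
    "\<And>g u. \<lbrakk>g \<in> carrier G; u \<in> points V\<rbrakk> \<Longrightarrow> k (lact V g u) = lact W g (k u)"
    "\<And>u h. \<lbrakk>u \<in> points V; h \<in> carrier H\<rbrakk> \<Longrightarrow> k (ract V u h) = ract W (k u) h"
    using assms(2) unfolding biset_iso_def by blast
  have "f u \<in> points V" if "u \<in> points U" for u
    using f(1) that by (auto simp: bij_betw_def)
  then show ?thesis
    unfolding biset_iso_def using f k
    by (intro exI[of _ "k \<circ> f"]) (auto intro: bij_betw_trans)
qed

text \<open>Both actions are transported along an enumeration of the finitely many points. Since
  \<open>biset_class\<close> collects only bisets on natural numbers, this is what keeps the classes
  from being empty.\<close>

lemma ex_nat_biset:
  assumes "biset G H U"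
  obtains X :: "('g, 'h, nat) biset"
  where "biset G H X" and "biset_iso G H X U"
proof -
  interpret biset G H U by fact
  obtain h where h: "bij_betw h (points U) {0..<card (points U)}"
    using ex_bij_betw_finite_nat[OF finite_points] by blast
  let ?k = "inv_into (points U) h"
  have kh [simp]: "?k (h u) = u" if "u \<in> points U" for u
    using bij_betw_inv_into_left[OF h that] .
  have h_image: "h ` points U = {0..<card (points U)}"
    using h by (simp add: bij_betw_def)
  define X :: "('g, 'h, nat) biset" where
    "X = \<lparr>points = h ` points U, lact = (\<lambda>g n. h (lact U g (?k n))), ract = (\<lambda>n l. h (ract U (?k n) l))\<rparr>"
  have X: "biset G H X"
    by unfold_locales
      (auto simp: X_def finite_points lact_closed ract_closed lact_one ract_one lact_mult ract_mult
        commuting)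
  have "biset_iso G H U X"
    unfolding biset_iso_def
    by (intro exI[of _ h]) (use h in \<open>auto simp: X_def h_image\<close>)
  with X show thesis using that biset_iso_sym[OF assms] by blast
qed

section \<open>Isomorphism classes of bisets\<close>

lemma biset_class_eqI:
  assumes "biset G H U" and "biset_iso G H U V"
  shows "biset_class G H U = biset_class G H V"
  unfolding biset_class_def
  by (blast intro: biset_iso_trans[OF _ biset_iso_sym[OF assms]] biset_iso_trans[OF _ assms(2)])

lemma biset_class_nonempty:
  assumes "biset G H U"
  shows "biset_class G H U \<noteq> {}"
  unfolding biset_class_def using assms by (rule ex_nat_biset) auto

lemma biset_class_in_classes:
  assumes "biset G H U"
  shows "biset_class G H U \<in> biset_classes G H"
proof -
  obtain X :: "('a, 'b, nat) biset" where X: "biset G H X" "biset_iso G H X U"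
    using assms by (rule ex_nat_biset)
  then have "biset_class G H U = biset_class G H X"
    using biset_class_eqI[OF X] by simp
  with X(1) show ?thesis unfolding biset_classes_def by blast
qed

lemma biset_classesE:
  assumes "p \<in> biset_classes G H"
  obtains U :: "('g, 'h, nat) biset" where "biset G H U" and "p = biset_class G H U"
  using assms unfolding biset_classes_def by blast

section \<open>Disjoint unions of bisets\<close>

lemma biset_disjoint_union:
  assumes "biset G H U" and "biset G H V"
  shows "biset G H (disjoint_union U V)"
proof -
  interpret U: biset G H U by fact
  interpret V: biset G H V by fact
  show ?thesis
    by unfold_locales
      (auto simp: disjoint_union_def U.finite_points V.finite_points U.lact_closed V.lact_closed
        U.ract_closed V.ract_closed U.lact_one V.lact_one U.ract_one V.ract_one U.lact_mult
        V.lact_mult U.ract_mult V.ract_mult U.commuting V.commuting)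
qed

lemma disjoint_union_iso:
  assumes "biset_iso G H U U'" and "biset_iso G H V V'"
  shows "biset_iso G H (disjoint_union U V) (disjoint_union U' V')"
proof -
  obtain f where f: "bij_betw f (points U) (points U')"
    "\<And>g u. \<lbrakk>g \<in> carrier G; u \<in> points U\<rbrakk> \<Longrightarrow> f (lact U g u) = lact U' g (f u)"
    "\<And>u h. \<lbrakk>u \<in> points U; h \<in> carrier H\<rbrakk> \<Longrightarrow> f (ract U u h) = ract U' (f u) h"
    using assms(1) unfolding biset_iso_def by blast
  obtain k where k: "bij_betw k (points V) (points V')"
    "\<And>g u. \<lbrakk>g \<in> carrier G; u \<in> points V\<rbrakk> \<Longrightarrow> k (lact V g u) = lact V' g (k u)"
    "\<And>u h. \<lbrakk>u \<in> points V; h \<in> carrier H\<rbrakk> \<Longrightarrow> k (ract V u h) = ract V' (k u) h"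
    using assms(2) unfolding biset_iso_def by blast
  have "inj_on (map_sum f k) (points U <+> points V)"
    by (rule inj_onI)
      (auto dest: inj_onD[OF bij_betw_imp_inj_on[OF f(1)]] inj_onD[OF bij_betw_imp_inj_on[OF k(1)]])
  moreover have "map_sum f k ` (points U <+> points V) = points U' <+> points V'"
    by (simp add: Plus_def image_Un image_image flip: bij_betw_imp_surj_on[OF f(1)]
        bij_betw_imp_surj_on[OF k(1)])
  ultimately have "bij_betw (map_sum f k) (points U <+> points V) (points U' <+> points V')"
    by (simp add: bij_betw_def)
  then show ?thesis
    unfolding biset_iso_def using f(2,3) k(2,3)
    by (intro exI[of _ "map_sum f k"]) (auto simp: disjoint_union_def)
qed

section \<open>The product of bisets\<close>

locale composable_bisets =
  U: biset G H U + W: biset H L W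
  for G :: "'g monoid" and H :: "'h monoid" and L :: "'l monoid"
    and U :: "('g, 'h, 'u) biset" and W :: "('h, 'l, 'w) biset"
begin

text \<open>The elementary tensor of \<open>u\<close> and \<open>w\<close>; every point of the
  product biset has this form.\<close>

abbreviation pair_class :: "'u \<Rightarrow> 'w \<Rightarrow> ('u \<times> 'w) set" where
  "pair_class u w \<equiv> tensor_rel H U W `` {(u, w)}"

text \<open>Solving \<open>u = ract U u' h\<close> for \<open>u'\<close> exhibits the relation as
  lying in one orbit of \<open>H\<close>, where \<open>h\<close> sends a pair to its translate by
  the inverse of \<open>h\<close> on the left factor and by \<open>h\<close> on the right
  factor.\<close>

lemma tensor_rel_iff:
  "((u, w), (u', w')) \<in> tensor_rel H U W \<longleftrightarrow> u \<in> points U \<and> w \<in> points W \<and>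
     (\<exists>h\<in>carrier H. u' = ract U u (inv\<^bsub>H\<^esub> h) \<and> w' = lact W h w)" (is "?l \<longleftrightarrow> ?r")
proof
  assume ?l
  then obtain h where h: "h \<in> carrier H" "u' \<in> points U" "w \<in> points W"
    "u = ract U u' h" "w' = lact W h w"
    unfolding tensor_rel_def by blast
  then have "ract U u (inv\<^bsub>H\<^esub> h) = u'"
    by (simp flip: U.ract_mult add: U.ract_one)
  moreover have "u \<in> points U" unfolding h(4) using h(1,2) by (rule U.ract_closed[rotated])
  ultimately show ?r using h(1,3,5) by (intro conjI bexI[of _ h]) simp_all
next
  assume ?r
  then obtain h where h: "h \<in> carrier H" "u \<in> points U" "w \<in> points W"
    "u' = ract U u (inv\<^bsub>H\<^esub> h)" "w' = lact W h w"
    by blast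
  then have "ract U u' h = u"
    by (simp flip: U.ract_mult add: U.ract_one)
  moreover have "u' \<in> points U" unfolding h(4) using h(1,2) by (intro U.ract_closed) simp_all
  ultimately show ?l unfolding tensor_rel_def using h(1,3,5)
    by (intro CollectI exI[of _ u'] exI[of _ h] exI[of _ w]) simp
qed

lemma pair_class_eq:
  assumes "u \<in> points U" and "w \<in> points W"
  shows "pair_class u w = (\<lambda>h. (ract U u (inv\<^bsub>H\<^esub> h), lact W h w)) ` carrier H"
  using assms by (auto simp: tensor_rel_iff)

text \<open>Being in one orbit of a group action is an equivalence: the witnesses are the unit, the
  inverse of \<open>h\<close>, and the product of \<open>k\<close> and \<open>h\<close> in this
  order.\<close>

lemma equiv_tensor_rel: "equiv (points U \<times> points W) (tensor_rel H U W)"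
proof (rule equivI)
  show "tensor_rel H U W \<subseteq> (points U \<times> points W) \<times> (points U \<times> points W)"
    using U.ract_closed W.lact_closed by (auto simp: tensor_rel_def)
  show "refl_on (points U \<times> points W) (tensor_rel H U W)"
    by (auto simp: refl_on_def tensor_rel_iff U.ract_one W.lact_one
        intro!: bexI[of _ "\<one>\<^bsub>H\<^esub>"])
  show "sym (tensor_rel H U W)"
  proof (rule symI, clarify)
    fix u w u' w' assume "((u, w), (u', w')) \<in> tensor_rel H U W"
    then obtain h where h: "h \<in> carrier H" "u \<in> points U" "w \<in> points W"
      "u' = ract U u (inv\<^bsub>H\<^esub> h)" "w' = lact W h w"
      by (auto simp: tensor_rel_iff)
    then show "((u', w'), (u, w)) \<in> tensor_rel H U W"
      by (auto simp: tensor_rel_iff U.ract_closed W.lact_closed U.ract_one W.lact_one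
          simp flip: U.ract_mult W.lact_mult intro!: bexI[of _ "inv\<^bsub>H\<^esub> h"])
  qed
  show "trans (tensor_rel H U W)"
  proof (rule transI, clarify)
    fix u w u' w' u'' w''
    assume "((u, w), (u', w')) \<in> tensor_rel H U W" "((u', w'), (u'', w'')) \<in> tensor_rel H U W"
    then obtain h k where h: "h \<in> carrier H" "u \<in> points U" "w \<in> points W"
      "u' = ract U u (inv\<^bsub>H\<^esub> h)" "w' = lact W h w" "k \<in> carrier H"
      "u'' = ract U u' (inv\<^bsub>H\<^esub> k)" "w'' = lact W k w'"
      by (auto simp: tensor_rel_iff)
    then show "((u, w), (u'', w'')) \<in> tensor_rel H U W"
      by (auto simp: tensor_rel_iff U.H.inv_mult_group
          simp flip: U.ract_mult W.lact_mult intro!: bexI[of _ "k \<otimes>\<^bsub>H\<^esub> h"])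
  qed
qed

lemma pair_class_eq_iff:
  assumes "u \<in> points U" "w \<in> points W" "u' \<in> points U" "w' \<in> points W"
  shows "pair_class u w = pair_class u' w' \<longleftrightarrow> ((u, w), (u', w')) \<in> tensor_rel H U W"
  using eq_equiv_class_iff[OF equiv_tensor_rel] assms by simp

lemma pair_class_balanced:
  assumes "u \<in> points U" "w \<in> points W" "h \<in> carrier H"
  shows "pair_class (ract U u h) w = pair_class u (lact W h w)"
  using assms U.ract_closed W.lact_closed
  by (subst pair_class_eq_iff) (auto simp: tensor_rel_def)

lemma pair_class_in_points:
  "\<lbrakk>u \<in> points U; w \<in> points W\<rbrakk> \<Longrightarrow> pair_class u w \<in> points (biset_prod H U W)"
  by (simp add: biset_prod_def quotientI)

lemma biset_prod_pointE:
  assumes "c \<in> points (biset_prod H U W)"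
  obtains u w where "u \<in> points U" "w \<in> points W" "c = pair_class u w"
  using assms by (auto simp: biset_prod_def elim!: quotientE)

text \<open>The action on classes is defined by taking images. Because the two actions on
  \<open>U\<close> commute, the image of an orbit is the orbit of the translated pair.\<close>

lemma lact_pair_class:
  assumes "g \<in> carrier G" "u \<in> points U" "w \<in> points W"
  shows "lact (biset_prod H U W) g (pair_class u w) = pair_class (lact U g u) w"
  using assms by (simp add: pair_class_eq U.lact_closed biset_prod_def image_image U.commuting)

lemma ract_pair_class:
  assumes "l \<in> carrier L" "u \<in> points U" "w \<in> points W"
  shows "ract (biset_prod H U W) (pair_class u w) l = pair_class u (ract W w l)"
  using assms by (simp add: pair_class_eq W.ract_closed biset_prod_def image_image W.commuting)

lemma biset_biset_prod: "biset G L (biset_prod H U W)"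
proof unfold_locales
  show "finite (points (biset_prod H U W))"
    unfolding biset_prod_def
    by (simp add: U.finite_points W.finite_points quotient_def)
qed (auto elim!: biset_prod_pointE simp: lact_pair_class ract_pair_class pair_class_in_points
    U.lact_closed W.ract_closed U.lact_one W.ract_one U.lact_mult W.ract_mult)

text \<open>The universal property of the product: a balanced map factors through the quotient,
  \<open>onto\<close> and \<open>inj\<close> make the factored map bijective, and \<open>l\<close>
  and \<open>r\<close> make it equivariant.\<close>

lemma biset_prod_isoI:
  assumes closed: "\<And>u w. \<lbrakk>u \<in> points U; w \<in> points W\<rbrakk> \<Longrightarrow> \<phi> u w \<in> points Z"
    and onto: "\<And>z. z \<in> points Z \<Longrightarrow> \<exists>u\<in>points U. \<exists>w\<in>points W. z = \<phi> u w"
    and balanced: "\<And>u h w. \<lbrakk>u \<in> points U; h \<in> carrier H; w \<in> points W\<rbrakk>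
      \<Longrightarrow> \<phi> (ract U u h) w = \<phi> u (lact W h w)"
    and inj: "\<And>u w u' w'. \<lbrakk>u \<in> points U; w \<in> points W; u' \<in> points U; w' \<in> points W;
      \<phi> u w = \<phi> u' w'\<rbrakk> \<Longrightarrow> ((u, w), (u', w')) \<in> tensor_rel H U W"
    and l: "\<And>g u w. \<lbrakk>g \<in> carrier G; u \<in> points U; w \<in> points W\<rbrakk>
      \<Longrightarrow> \<phi> (lact U g u) w = lact Z g (\<phi> u w)"
    and r: "\<And>u w l. \<lbrakk>u \<in> points U; w \<in> points W; l \<in> carrier L\<rbrakk>
      \<Longrightarrow> \<phi> u (ract W w l) = ract Z (\<phi> u w) l"
  shows "biset_iso G L (biset_prod H U W) Z"
proof -
  \<comment> \<open>A balanced map is constant on each class, so the image of a class is a singleton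
    and \<open>the_elem\<close> returns the common value.\<close>
  define F where "F c = the_elem ((\<lambda>(u, w). \<phi> u w) ` c)" for c
  have F: "F (pair_class u w) = \<phi> u w" if uw: "u \<in> points U" "w \<in> points W" for u w
  proof -
    show ?thesis unfolding F_def
    proof (rule the_elem_image_unique)
      show "pair_class u w \<noteq> {}"
        using equiv_class_self[OF equiv_tensor_rel] uw by blast
      show "(\<lambda>(u, w). \<phi> u w) x = \<phi> u w" if "x \<in> pair_class u w" for x
        using that by (auto simp: tensor_rel_def balanced)
    qed
  qed
  have "inj_on F (points (biset_prod H U W))"
  proof (rule inj_onI)
    fix c d
    assume cd: "c \<in> points (biset_prod H U W)" "d \<in> points (biset_prod H U W)" "F c = F d"
    obtain u w where c: "u \<in> points U" "w \<in> points W" "c = pair_class u w"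
      using cd(1) by (rule biset_prod_pointE)
    obtain u' w' where d: "u' \<in> points U" "w' \<in> points W" "d = pair_class u' w'"
      using cd(2) by (rule biset_prod_pointE)
    have "\<phi> u w = \<phi> u' w'" using cd(3) c d by (simp only: F)
    then have "((u, w), (u', w')) \<in> tensor_rel H U W" by (intro inj c d)
    then show "c = d" using pair_class_eq_iff[OF c(1,2) d(1,2)] c(3) d(3) by simp
  qed
  moreover have "F ` points (biset_prod H U W) = points Z"
  proof
    show "F ` points (biset_prod H U W) \<subseteq> points Z"
      by (auto elim!: biset_prod_pointE simp: F closed)
    show "points Z \<subseteq> F ` points (biset_prod H U W)"
    proof
      fix z assume "z \<in> points Z"
      then obtain u w where "u \<in> points U" "w \<in> points W" "z = \<phi> u w" using onto by blast
      then show "z \<in> F ` points (biset_prod H U W)"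
        by (intro image_eqI[of _ _ "pair_class u w"]) (simp_all add: F pair_class_in_points)
    qed
  qed
  ultimately show ?thesis
    unfolding biset_iso_def
    by (intro exI[of _ F])
      (auto elim!: biset_prod_pointE simp: bij_betw_def F lact_pair_class ract_pair_class
        U.lact_closed W.ract_closed l r)
qed

end

section \<open>Invariance and distributivity of the product\<close>

lemma composable_bisetsI:
  "\<lbrakk>biset G H U; biset H L W\<rbrakk> \<Longrightarrow> composable_bisets G H L U W"
  by (simp add: composable_bisets_def)

lemma biset_biset_prod:
  "\<lbrakk>biset G H U; biset H L W\<rbrakk> \<Longrightarrow> biset G L (biset_prod H U W)"
  by (rule composable_bisets.biset_biset_prod[OF composable_bisetsI])

text \<open>Tensoring the two isomorphisms gives the required one; this makes the product depend on
  isomorphism classes only.\<close>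

lemma biset_prod_iso:
  assumes U: "biset G H U" "biset G H U'" "biset_iso G H U U'"
    and W: "biset H L W" "biset H L W'" "biset_iso H L W W'"
  shows "biset_iso G L (biset_prod H U W) (biset_prod H U' W')"
proof -
  interpret P: composable_bisets G H L U W using U W by (intro composable_bisetsI)
  interpret P': composable_bisets G H L U' W' using U W by (intro composable_bisetsI)
  obtain f where f: "bij_betw f (points U) (points U')"
    "\<And>g u. \<lbrakk>g \<in> carrier G; u \<in> points U\<rbrakk> \<Longrightarrow> f (lact U g u) = lact U' g (f u)"
    "\<And>u h. \<lbrakk>u \<in> points U; h \<in> carrier H\<rbrakk> \<Longrightarrow> f (ract U u h) = ract U' (f u) h"
    using U(3) unfolding biset_iso_def by blast
  obtain k where k: "bij_betw k (points W) (points W')"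
    "\<And>g u. \<lbrakk>g \<in> carrier H; u \<in> points W\<rbrakk> \<Longrightarrow> k (lact W g u) = lact W' g (k u)"
    "\<And>u h. \<lbrakk>u \<in> points W; h \<in> carrier L\<rbrakk> \<Longrightarrow> k (ract W u h) = ract W' (k u) h"
    using W(3) unfolding biset_iso_def by blast
  have fU: "f u \<in> points U'" if "u \<in> points U" for u
    using f(1) that by (auto simp: bij_betw_def)
  have kW: "k w \<in> points W'" if "w \<in> points W" for w
    using k(1) that by (auto simp: bij_betw_def)
  show ?thesis
  proof (rule P.biset_prod_isoI[where \<phi> = "\<lambda>u w. P'.pair_class (f u) (k w)"])
    fix z assume "z \<in> points (biset_prod H U' W')"
    then obtain u w where uw: "u \<in> points U'" "w \<in> points W'" "z = P'.pair_class u w"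
      by (rule P'.biset_prod_pointE)
    then obtain u0 w0 where "u0 \<in> points U" "w0 \<in> points W" "u = f u0" "w = k w0"
      using f(1) k(1) unfolding bij_betw_def by blast
    with uw(3) show "\<exists>u\<in>points U. \<exists>w\<in>points W. z = P'.pair_class (f u) (k w)" by blast
  next
    fix u w u' w'
    assume uw: "u \<in> points U" "w \<in> points W" "u' \<in> points U" "w' \<in> points W"
      and eq: "P'.pair_class (f u) (k w) = P'.pair_class (f u') (k w')"
    from eq obtain h where h: "h \<in> carrier H" "f u' = ract U' (f u) (inv\<^bsub>H\<^esub> h)"
      "k w' = lact W' h (k w)"
      using uw by (auto simp: P'.pair_class_eq_iff fU kW P'.tensor_rel_iff)
    \<comment> \<open>Equivariance moves the element \<open>h\<close> witnessing the relation inside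
      \<open>f\<close> and \<open>k\<close>; injectivity then shows that the same \<open>h\<close>
      relates the original pairs.\<close>
    then have "f u' = f (ract U u (inv\<^bsub>H\<^esub> h))" "k w' = k (lact W h w)"
      using uw by (simp_all add: f k)
    then have "u' = ract U u (inv\<^bsub>H\<^esub> h)" "w' = lact W h w"
      using f(1) k(1) uw h(1) P.U.ract_closed[OF uw(1), of "inv\<^bsub>H\<^esub> h"] P.W.lact_closed[of h w]
      by (auto simp: bij_betw_def dest!: inj_onD)
    with uw h(1) show "((u, w), (u', w')) \<in> tensor_rel H U W"
      by (auto simp: P.tensor_rel_iff)
  qed (simp_all add: f k fU kW P'.pair_class_in_points P'.pair_class_balanced P'.lact_pair_class
      P'.ract_pair_class)
qed

text \<open>The action of \<open>H\<close> preserves the two summands, so each class of pairs lies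
  over exactly one of them. Together with its mirror image below, this is the source of
  bilinearity.\<close>

lemma biset_prod_disjoint_union_left:
  assumes U: "biset G H U" and V: "biset G H V" and W: "biset H L W"
  shows "biset_iso G L (biset_prod H (disjoint_union U V) W)
    (disjoint_union (biset_prod H U W) (biset_prod H V W))"
proof -
  interpret P: composable_bisets G H L "disjoint_union U V" W
    using assms by (intro composable_bisetsI biset_disjoint_union)
  interpret PU: composable_bisets G H L U W using assms by (intro composable_bisetsI)
  interpret PV: composable_bisets G H L V W using assms by (intro composable_bisetsI)
  let ?\<phi> = "\<lambda>x w. map_sum (\<lambda>u. PU.pair_class u w) (\<lambda>v. PV.pair_class v w) x"
  show ?thesis
  proof (rule P.biset_prod_isoI[where \<phi> = ?\<phi>])
    fix z assume "z \<in> points (disjoint_union (biset_prod H U W) (biset_prod H V W))"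
    then consider c where "c \<in> points (biset_prod H U W)" "z = Inl c"
      | c where "c \<in> points (biset_prod H V W)" "z = Inr c"
      by (auto simp: disjoint_union_def)
    then show "\<exists>x\<in>points (disjoint_union U V). \<exists>w\<in>points W. z = ?\<phi> x w"
    proof cases
      case 1
      then obtain u w where "u \<in> points U" "w \<in> points W" "z = ?\<phi> (Inl u) w"
        by (auto elim: PU.biset_prod_pointE)
      then show ?thesis unfolding disjoint_union_def by (intro bexI[of _ "Inl u"] bexI[of _ w]) auto
    next
      case 2
      then obtain v w where "v \<in> points V" "w \<in> points W" "z = ?\<phi> (Inr v) w"
        by (auto elim: PV.biset_prod_pointE)
      then show ?thesis unfolding disjoint_union_def by (intro bexI[of _ "Inr v"] bexI[of _ w]) auto
    qed
  qed (auto simp: disjoint_union_def PU.pair_class_in_points PV.pair_class_in_points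
      PU.pair_class_balanced PV.pair_class_balanced PU.lact_pair_class PV.lact_pair_class
      PU.ract_pair_class PV.ract_pair_class PU.pair_class_eq_iff PV.pair_class_eq_iff
      PU.tensor_rel_iff PV.tensor_rel_iff P.tensor_rel_iff[unfolded disjoint_union_def])
qed

lemma biset_prod_disjoint_union_right:
  assumes U: "biset G H U" and V: "biset H L V" and W: "biset H L W"
  shows "biset_iso G L (biset_prod H U (disjoint_union V W))
    (disjoint_union (biset_prod H U V) (biset_prod H U W))"
proof -
  interpret P: composable_bisets G H L U "disjoint_union V W"
    using assms by (intro composable_bisetsI biset_disjoint_union)
  interpret PV: composable_bisets G H L U V using assms by (intro composable_bisetsI)
  interpret PW: composable_bisets G H L U W using assms by (intro composable_bisetsI)
  let ?\<phi> = "\<lambda>u x. map_sum (\<lambda>v. PV.pair_class u v) (\<lambda>w. PW.pair_class u w) x"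
  show ?thesis
  proof (rule P.biset_prod_isoI[where \<phi> = ?\<phi>])
    fix z assume "z \<in> points (disjoint_union (biset_prod H U V) (biset_prod H U W))"
    then consider c where "c \<in> points (biset_prod H U V)" "z = Inl c"
      | c where "c \<in> points (biset_prod H U W)" "z = Inr c"
      by (auto simp: disjoint_union_def)
    then show "\<exists>u\<in>points U. \<exists>x\<in>points (disjoint_union V W). z = ?\<phi> u x"
    proof cases
      case 1
      then obtain u v where "u \<in> points U" "v \<in> points V" "z = ?\<phi> u (Inl v)"
        by (auto elim: PV.biset_prod_pointE)
      then show ?thesis unfolding disjoint_union_def by (intro bexI[of _ u] bexI[of _ "Inl v"]) auto
    next
      case 2
      then obtain u w where "u \<in> points U" "w \<in> points W" "z = ?\<phi> u (Inr w)"
        by (auto elim: PW.biset_prod_pointE)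
      then show ?thesis unfolding disjoint_union_def by (intro bexI[of _ u] bexI[of _ "Inr w"]) auto
    qed
  qed (auto simp: disjoint_union_def PV.pair_class_in_points PW.pair_class_in_points
      PV.pair_class_balanced PW.pair_class_balanced PV.lact_pair_class PW.lact_pair_class
      PV.ract_pair_class PW.ract_pair_class PV.pair_class_eq_iff PW.pair_class_eq_iff
      PV.tensor_rel_iff PW.tensor_rel_iff P.tensor_rel_iff[unfolded disjoint_union_def])
qed

text \<open>By invariance under isomorphism, the union defining \<open>class_prod\<close> runs over
  copies of one and the same class.\<close>

lemma class_prod_biset_class:
  fixes G :: "'g monoid" and H :: "'h monoid" and L :: "'l monoid"
  assumes U: "biset G H U" and W: "biset H L W"
  shows "class_prod G H L (biset_class G H U) (biset_class H L W)
    = biset_class G L (biset_prod H U W)"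
proof -
  have eq: "biset_class G L (biset_prod H X Y) = biset_class G L (biset_prod H U W)"
    if "X \<in> biset_class G H U" "Y \<in> biset_class H L W" for X Y
    using that U W unfolding biset_class_def[of G H] biset_class_def[of H L]
    by (intro biset_class_eqI biset_biset_prod biset_prod_iso) simp_all
  moreover have "biset_class G H U \<noteq> {}" "biset_class H L W \<noteq> {}"
    by (rule biset_class_nonempty[OF U], rule biset_class_nonempty[OF W])
  ultimately show ?thesis
    unfolding class_prod_def by (intro UN2_constant)
qed

section \<open>Products in the biset category\<close>

text \<open>The defining relations range over bisets on natural numbers, whereas the points of a
  product are sets of pairs. Passing to numbered copies extends the relations to all point
  types.\<close>

lemma burnside_relation:
  fixes G :: "'g monoid" and H :: "'h monoid"
  assumes U: "biset G H U" and V: "biset G H V"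
  shows "frag_of (biset_class G H (disjoint_union U V)) - frag_of (biset_class G H U)
    - frag_of (biset_class G H V) \<in> burnside_relations G H"
proof -
  obtain X :: "('g, 'h, nat) biset" where X: "biset G H X" "biset_iso G H X U"
    using U by (rule ex_nat_biset)
  obtain Y :: "('g, 'h, nat) biset" where Y: "biset G H Y" "biset_iso G H Y V"
    using V by (rule ex_nat_biset)
  have "biset_class G H (disjoint_union X Y) = biset_class G H (disjoint_union U V)"
    by (intro biset_class_eqI biset_disjoint_union disjoint_union_iso X Y)
  then have "frag_of (biset_class G H (disjoint_union U V)) - frag_of (biset_class G H U)
      - frag_of (biset_class G H V)
    = frag_of (biset_class G H (disjoint_union X Y)) - frag_of (biset_class G H X)
      - frag_of (biset_class G H Y)"
    using biset_class_eqI[OF X] biset_class_eqI[OF Y] by simp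
  then show ?thesis
    unfolding burnside_relations_def using X(1) Y(1) by blast
qed

lemma burnside_relationsE:
  fixes G :: "'g monoid" and H :: "'h monoid"
  assumes "r \<in> burnside_relations G H"
  obtains U V :: "('g, 'h, nat) biset" where "biset G H U" "biset G H V"
    "r = frag_of (biset_class G H (disjoint_union U V)) - frag_of (biset_class G H U)
      - frag_of (biset_class G H V)"
  using assms unfolding burnside_relations_def by blast

lemma keys_frag_diff:
  assumes "Poly_Mapping.keys x \<subseteq> S" and "Poly_Mapping.keys y \<subseteq> S"
  shows "Poly_Mapping.keys (x - y) \<subseteq> S"
  using keys_diff[of x y] assms by blast

lemma keys_frag_add:
  assumes "Poly_Mapping.keys x \<subseteq> S" and "Poly_Mapping.keys y \<subseteq> S"
  shows "Poly_Mapping.keys (x + y) \<subseteq> S"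
  using keys_add[of x y] assms by blast

section \<open>Burnside groups and their bilinear product\<close>

lemma presentation_burnside: "presentation (biset_classes G H) (burnside_relations G H)"
proof
  show "burnside_relations G H \<subseteq> carrier (free_Abelian_group (biset_classes G H))"
  proof
    fix r assume "r \<in> burnside_relations G H"
    then show "r \<in> carrier (free_Abelian_group (biset_classes G H))"
    proof (rule burnside_relationsE)
      fix U V :: "('a, 'b, nat) biset"
      assume "biset G H U" "biset G H V"
        and "r = frag_of (biset_class G H (disjoint_union U V)) - frag_of (biset_class G H U)
          - frag_of (biset_class G H V)"
      then show ?thesis
        by (simp add: keys_frag_diff biset_class_in_classes biset_disjoint_union)
    qed
  qed
qed

text \<open>The rewrites state the facts about presented groups directly for
  \<open>burnside_group\<close> and \<open>burnside_class\<close>, for all \<open>G\<close> and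
  \<open>H\<close> at once.\<close>

interpretation burnside: presentation "biset_classes G H" "burnside_relations G H"
  rewrites "presented_group (biset_classes G H) (burnside_relations G H) \<equiv> burnside_group G H"
    and "presented_class (biset_classes G H) (burnside_relations G H) \<equiv> burnside_class G H"
  by (rule presentation_burnside) (simp_all add: burnside_group_def burnside_class_def)

lemma burnside_groupE:
  assumes "b \<in> carrier (burnside_group G H)"
  obtains x where "Poly_Mapping.keys x \<subseteq> biset_classes G H" "b = burnside_class G H x"
  using assms by (auto simp: burnside.carrier_presented_group)

text \<open>As the product distributes over disjoint unions, a defining relation multiplied by a
  generator is again a defining relation, on either side.\<close>

lemma presented_bilinear_burnside:
  "presented_bilinear (biset_classes G H) (burnside_relations G H) (biset_classes H L)
     (burnside_relations H L) (biset_classes G L) (burnside_relations G L)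
     (\<lambda>p q. frag_of (class_prod G H L p q))"
proof (intro presented_bilinear.intro presentation_burnside presented_bilinear_axioms.intro)
  fix r t assume "r \<in> burnside_relations G H" "t \<in> biset_classes H L"
  then obtain U V :: "('a, 'b, nat) biset" and W :: "('b, 'c, nat) biset"
    where UVW: "biset G H U" "biset G H V" "biset H L W"
      and r: "r = frag_of (biset_class G H (disjoint_union U V)) - frag_of (biset_class G H U)
        - frag_of (biset_class G H V)"
      and t: "t = biset_class H L W"
    by (blast elim: burnside_relationsE biset_classesE)
  have "biset_class G L (biset_prod H (disjoint_union U V) W)
      = biset_class G L (disjoint_union (biset_prod H U W) (biset_prod H V W))"
    by (intro biset_class_eqI biset_biset_prod biset_prod_disjoint_union_left
        biset_disjoint_union UVW)
  then have "frag_extend2 (\<lambda>p q. frag_of (class_prod G H L p q)) r (frag_of t)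
      = frag_of (biset_class G L (disjoint_union (biset_prod H U W) (biset_prod H V W)))
        - frag_of (biset_class G L (biset_prod H U W))
        - frag_of (biset_class G L (biset_prod H V W))"
    by (simp add: r t frag_extend2_diff1 class_prod_biset_class UVW biset_disjoint_union)
  then show "frag_extend2 (\<lambda>p q. frag_of (class_prod G H L p q)) r (frag_of t)
      \<in> relators (biset_classes G L) (burnside_relations G L)"
    by (simp add: relators_incl burnside_relation biset_biset_prod UVW)
next
  fix s q assume "s \<in> biset_classes G H" "q \<in> burnside_relations H L"
  then obtain U V :: "('b, 'c, nat) biset" and W :: "('a, 'b, nat) biset"
    where UVW: "biset H L U" "biset H L V" "biset G H W"
      and q: "q = frag_of (biset_class H L (disjoint_union U V)) - frag_of (biset_class H L U)
        - frag_of (biset_class H L V)"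
      and s: "s = biset_class G H W"
    by (blast elim: burnside_relationsE biset_classesE)
  have "biset_class G L (biset_prod H W (disjoint_union U V))
      = biset_class G L (disjoint_union (biset_prod H W U) (biset_prod H W V))"
    by (intro biset_class_eqI biset_biset_prod biset_prod_disjoint_union_right
        biset_disjoint_union UVW)
  then have "frag_extend2 (\<lambda>p q. frag_of (class_prod G H L p q)) (frag_of s) q
      = frag_of (biset_class G L (disjoint_union (biset_prod H W U) (biset_prod H W V)))
        - frag_of (biset_class G L (biset_prod H W U))
        - frag_of (biset_class G L (biset_prod H W V))"
    by (simp add: q s frag_extend2_diff2 class_prod_biset_class UVW biset_disjoint_union)
  then show "frag_extend2 (\<lambda>p q. frag_of (class_prod G H L p q)) (frag_of s) q
      \<in> relators (biset_classes G L) (burnside_relations G L)"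
    by (simp add: relators_incl burnside_relation biset_biset_prod UVW)
qed

lemma burnside_prod_class:
  assumes "Poly_Mapping.keys x \<subseteq> biset_classes G H" and "Poly_Mapping.keys y \<subseteq> biset_classes H L"
  shows "burnside_prod G H L (burnside_class G H x) (burnside_class H L y)
    = burnside_class G L (frag_extend2 (\<lambda>p q. frag_of (class_prod G H L p q)) x y)"
  using presented_bilinear.presented_class_frag_extend2[OF presented_bilinear_burnside assms]
  by (simp add: burnside_prod_def burnside_class_def)

lemma class_prod_in_classes:
  assumes "p \<in> biset_classes G H" and "q \<in> biset_classes H L"
  shows "class_prod G H L p q \<in> biset_classes G L"
  using assms
  by (auto elim!: biset_classesE simp: class_prod_biset_class biset_class_in_classes biset_biset_prod)

lemma burnside_prod_closed:
  assumes "b \<in> carrier (burnside_group G H)" and "c \<in> carrier (burnside_group H L)"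
  shows "burnside_prod G H L b c \<in> carrier (burnside_group G L)"
proof -
  obtain x where x: "Poly_Mapping.keys x \<subseteq> biset_classes G H" "b = burnside_class G H x"
    using assms(1) by (rule burnside_groupE)
  obtain y where y: "Poly_Mapping.keys y \<subseteq> biset_classes H L" "c = burnside_class H L y"
    using assms(2) by (rule burnside_groupE)
  have "Poly_Mapping.keys (frag_extend2 (\<lambda>p q. frag_of (class_prod G H L p q)) x y)
      \<subseteq> biset_classes G L"
    by (rule keys_frag_extend2[OF _ x(1) y(1)]) (simp add: class_prod_in_classes)
  then show ?thesis
    by (simp add: x y burnside_prod_class burnside.presented_class_closed)
qed

text \<open>Burnside groups are written multiplicatively, so this is additivity in the first
  argument; it is needed for the tensor relations below.\<close>

lemma burnside_prod_mult_left:
  assumes "b \<in> carrier (burnside_group G H)" "b' \<in> carrier (burnside_group G H)"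
    and "c \<in> carrier (burnside_group H L)"
  shows "burnside_prod G H L (b \<otimes>\<^bsub>burnside_group G H\<^esub> b') c
    = burnside_prod G H L b c \<otimes>\<^bsub>burnside_group G L\<^esub> burnside_prod G H L b' c"
  using assms
  by (auto elim!: burnside_groupE simp: burnside_prod_class burnside.mult_presented_group
      keys_frag_add frag_extend2_add1)

lemma burnside_prod_mult_right:
  assumes "b \<in> carrier (burnside_group G H)"
    and "c \<in> carrier (burnside_group H L)" "c' \<in> carrier (burnside_group H L)"
  shows "burnside_prod G H L b (c \<otimes>\<^bsub>burnside_group H L\<^esub> c')
    = burnside_prod G H L b c \<otimes>\<^bsub>burnside_group G L\<^esub> burnside_prod G H L b c'"
  using assms
  by (auto elim!: burnside_groupE simp: burnside_prod_class burnside.mult_presented_group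
      keys_frag_add frag_extend2_add2)

lemma burnside_group_mult_closed:
  assumes "b \<in> carrier (burnside_group G H)" "c \<in> carrier (burnside_group G H)"
  shows "b \<otimes>\<^bsub>burnside_group G H\<^esub> c \<in> carrier (burnside_group G H)"
  using assms
  by (elim burnside_groupE)
    (simp add: burnside.mult_presented_group burnside.presented_class_closed keys_frag_add)

section \<open>Extension of scalars\<close>

lemma presentation_tensor:
  assumes "\<And>a a'. \<lbrakk>a \<in> carrier A; a' \<in> carrier A\<rbrakk> \<Longrightarrow> a \<otimes>\<^bsub>A\<^esub> a' \<in> carrier A"
    and "\<And>b b'. \<lbrakk>b \<in> carrier B; b' \<in> carrier B\<rbrakk> \<Longrightarrow> b \<otimes>\<^bsub>B\<^esub> b' \<in> carrier B"
  shows "presentation (carrier A \<times> carrier B) (tensor_relations A B)"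
proof
  show "tensor_relations A B \<subseteq> carrier (free_Abelian_group (carrier A \<times> carrier B))"
  proof
    fix r assume "r \<in> tensor_relations A B"
    then show "r \<in> carrier (free_Abelian_group (carrier A \<times> carrier B))"
      unfolding tensor_relations_def carrier_free_Abelian_group_iff
      by (elim UnE CollectE exE conjE; simp only:) (intro keys_frag_diff; simp add: assms)+
  qed
qed

lemma presentation_kburnside:
  assumes "ring K"
  shows "presentation (carrier (add_monoid K) \<times> carrier (burnside_group G H))
    (tensor_relations (add_monoid K) (burnside_group G H))"
proof -
  interpret ring K by fact
  show ?thesis
    by (rule presentation_tensor) (simp_all add: burnside_group_mult_closed)
qed

text \<open>Distributivity in \<open>K\<close> handles the relations in the scalar and additivity of
  \<open>burnside_prod\<close> those in the Burnside group: a relation paired with a generator is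
  again a single tensor relation.\<close>

lemma presented_bilinear_kburnside:
  assumes "ring K"
  shows "presented_bilinear
     (carrier (add_monoid K) \<times> carrier (burnside_group G H))
     (tensor_relations (add_monoid K) (burnside_group G H))
     (carrier (add_monoid K) \<times> carrier (burnside_group H L))
     (tensor_relations (add_monoid K) (burnside_group H L))
     (carrier (add_monoid K) \<times> carrier (burnside_group G L))
     (tensor_relations (add_monoid K) (burnside_group G L))
     (\<lambda>(a, b) (a', b'). frag_of (a \<otimes>\<^bsub>K\<^esub> a', burnside_prod G H L b b'))"
proof (intro presented_bilinear.intro presentation_kburnside assms presented_bilinear_axioms.intro)
  interpret ring K by fact
  fix r t
  assume "r \<in> tensor_relations (add_monoid K) (burnside_group G H)"
    and "t \<in> carrier (add_monoid K) \<times> carrier (burnside_group H L)"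
  then show "frag_extend2 (\<lambda>(a, b) (a', b'). frag_of (a \<otimes>\<^bsub>K\<^esub> a', burnside_prod G H L b b'))
      r (frag_of t) \<in> relators (carrier (add_monoid K) \<times> carrier (burnside_group G L))
        (tensor_relations (add_monoid K) (burnside_group G L))"
    by (intro relators_incl)
      (auto simp: tensor_relations_def frag_extend2_diff1 l_distr burnside_prod_mult_left,
       (metis burnside_prod_closed m_closed)+)
next
  interpret ring K by fact
  fix s q
  assume "s \<in> carrier (add_monoid K) \<times> carrier (burnside_group G H)"
    and "q \<in> tensor_relations (add_monoid K) (burnside_group H L)"
  then show "frag_extend2 (\<lambda>(a, b) (a', b'). frag_of (a \<otimes>\<^bsub>K\<^esub> a', burnside_prod G H L b b'))
      (frag_of s) q \<in> relators (carrier (add_monoid K) \<times> carrier (burnside_group G L))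
        (tensor_relations (add_monoid K) (burnside_group G L))"
    by (intro relators_incl)
      (auto simp: tensor_relations_def frag_extend2_diff2 r_distr burnside_prod_mult_right,
       (metis burnside_prod_closed m_closed)+)
qed

lemma burnside_class_in_carrier:
  "biset G H U \<Longrightarrow>
    burnside_class G H (frag_of (biset_class G H U)) \<in> carrier (burnside_group G H)"
  by (rule burnside.presented_class_closed) (simp add: biset_class_in_classes)

lemma kbiset_closed:
  assumes "ring K" and "biset G H U"
  shows "kbiset K G H U \<in> carrier (kburnside K G H)"
proof -
  interpret ring K by fact
  have "kbiset K G H U \<in> carrier (tensor_group (add_monoid K) (burnside_group G H))"
    unfolding kbiset_def tensor_group_def tensor_class_def
    by (rule presentation.presented_class_closed[OF presentation_kburnside[OF assms(1)]])
      (simp add: burnside_class_in_carrier[OF assms(2)])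
  then show ?thesis
    by (simp add: kburnside_def scalar_extension_def)
qed

text \<open>Classes of bisets are represented by generators with coefficient one, where the bilinear
  extension is the original product and the coefficients multiply to one.\<close>

lemma kburnside_prod_kbiset:
  assumes "ring K" and U: "biset G H U" and W: "biset H L W"
  shows "kburnside_prod K G H L (kbiset K G H U) (kbiset K H L W) = kbiset K G L (biset_prod H U W)"
proof -
  interpret ring K by fact
  have "kburnside_prod K G H L (kbiset K G H U) (kbiset K H L W)
      = tensor_class (add_monoid K) (burnside_group G L)
         (frag_extend2 (\<lambda>(a, b) (a', b'). frag_of (a \<otimes>\<^bsub>K\<^esub> a', burnside_prod G H L b b'))
           (frag_of (\<one>\<^bsub>K\<^esub>, burnside_class G H (frag_of (biset_class G H U))))
           (frag_of (\<one>\<^bsub>K\<^esub>, burnside_class H L (frag_of (biset_class H L W)))))"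
    unfolding kburnside_prod_def kbiset_def tensor_class_def
    by (rule presented_bilinear.presented_class_frag_extend2[OF presented_bilinear_kburnside])
      (simp_all add: assms burnside_class_in_carrier)
  also have "\<dots> = kbiset K G L (biset_prod H U W)"
    by (simp add: kbiset_def burnside_prod_class biset_class_in_classes U W class_prod_biset_class)
  finally show ?thesis .
qed

lemma kbiset_eqI:
  "\<lbrakk>biset G H U; biset_iso G H U V\<rbrakk> \<Longrightarrow> kbiset K G H U = kbiset K G H V"
  unfolding kbiset_def using biset_class_eqI by metis

section \<open>Inflation and deflation\<close>

text \<open>For surjective \<open>\<pi>\<close> this is inflation from \<open>G\<close> modulo the
  kernel of \<open>\<pi>\<close>, combined with the induced isomorphism from that quotient to
  \<open>H\<close>.\<close>

definition inflation_biset :: "'h monoid \<Rightarrow> ('g \<Rightarrow> 'h) \<Rightarrow> ('g, 'h, 'h) biset" where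
  "inflation_biset H \<pi> =
     \<lparr>points = carrier H, lact = (\<lambda>g u. \<pi> g \<otimes>\<^bsub>H\<^esub> u), ract = (\<otimes>\<^bsub>H\<^esub>)\<rparr>"

definition deflation_biset :: "'h monoid \<Rightarrow> ('g \<Rightarrow> 'h) \<Rightarrow> ('h, 'g, 'h) biset" where
  "deflation_biset H \<pi> =
     \<lparr>points = carrier H, lact = (\<otimes>\<^bsub>H\<^esub>), ract = (\<lambda>u g. u \<otimes>\<^bsub>H\<^esub> \<pi> g)\<rparr>"

lemma biset_inflation_deflation:
  assumes "group G" "group H" "finite (carrier H)" "\<pi> \<in> hom G H"
  shows "biset G H (inflation_biset H \<pi>)" "biset H G (deflation_biset H \<pi>)"
proof -
  interpret group_hom G H \<pi>
    using assms by (simp add: group_hom_def group_hom_axioms_def)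
  show "biset G H (inflation_biset H \<pi>)"
    by unfold_locales (simp_all add: inflation_biset_def assms H.m_assoc)
  show "biset H G (deflation_biset H \<pi>)"
    by unfold_locales (simp_all add: deflation_biset_def assms H.m_assoc)
qed

text \<open>Multiplication in \<open>H\<close> induces the isomorphism. It is balanced by
  associativity; surjectivity of \<open>\<pi>\<close> enters for injectivity, as elements of
  \<open>G\<close> must identify all pairs with the same product.\<close>

lemma deflation_inflation_iso:
  assumes "group G" "group H" "finite (carrier H)" "\<pi> \<in> epi G H"
  shows "biset_iso H H (biset_prod G (deflation_biset H \<pi>) (inflation_biset H \<pi>))
    (regular_biset H)"
proof -
  have hom: "\<pi> \<in> hom G H" and onto: "\<pi> ` carrier G = carrier H"
    using assms(4) by (auto simp: epi_def)
  interpret group_hom G H \<pi>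
    using assms hom by (simp add: group_hom_def group_hom_axioms_def)
  interpret P: composable_bisets H G H "deflation_biset H \<pi>" "inflation_biset H \<pi>"
    using assms hom by (intro composable_bisetsI biset_inflation_deflation)
  show ?thesis
  proof (rule P.biset_prod_isoI[where \<phi> = "(\<otimes>\<^bsub>H\<^esub>)"])
    fix z assume "z \<in> points (regular_biset H)"
    then show "\<exists>u\<in>points (deflation_biset H \<pi>). \<exists>w\<in>points (inflation_biset H \<pi>). z = u \<otimes>\<^bsub>H\<^esub> w"
      by (intro bexI[of _ z] bexI[of _ "\<one>\<^bsub>H\<^esub>"])
        (simp_all add: regular_biset_def deflation_biset_def inflation_biset_def)
  next
    fix u w u' w'
    assume "u \<in> points (deflation_biset H \<pi>)" "w \<in> points (inflation_biset H \<pi>)"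
      "u' \<in> points (deflation_biset H \<pi>)" "w' \<in> points (inflation_biset H \<pi>)"
      and eq: "u \<otimes>\<^bsub>H\<^esub> w = u' \<otimes>\<^bsub>H\<^esub> w'"
    then have c: "u \<in> carrier H" "w \<in> carrier H" "u' \<in> carrier H" "w' \<in> carrier H"
      by (simp_all add: deflation_biset_def inflation_biset_def)
    \<comment> \<open>The element to be lifted is the one that carries \<open>u\<close> to
      \<open>u'\<close> through its inverse on the right. Equality of the two products makes the
      same lift carry \<open>w\<close> to \<open>w'\<close> on the left.\<close>
    then have "inv\<^bsub>H\<^esub> u' \<otimes>\<^bsub>H\<^esub> u \<in> \<pi> ` carrier G" using onto by simp
    then obtain g where g: "g \<in> carrier G" "\<pi> g = inv\<^bsub>H\<^esub> u' \<otimes>\<^bsub>H\<^esub> u" by force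
    have "u' = u \<otimes>\<^bsub>H\<^esub> \<pi> (inv\<^bsub>G\<^esub> g)"
      using c g by (simp add: H.inv_mult_group flip: H.m_assoc)
    moreover have "w' = \<pi> g \<otimes>\<^bsub>H\<^esub> w"
      using c by (simp add: g H.m_assoc eq) (simp flip: H.m_assoc)
    ultimately show "((u, w), (u', w')) \<in> tensor_rel G (deflation_biset H \<pi>) (inflation_biset H \<pi>)"
      using c g(1) unfolding P.tensor_rel_iff
      by (intro conjI bexI[of _ g]) (simp_all add: deflation_biset_def inflation_biset_def)
  qed (simp_all add: regular_biset_def deflation_biset_def inflation_biset_def H.m_assoc)
qed

text \<open>Morphisms from \<open>H\<close> to \<open>G\<close> are classes of bisets with
  \<open>G\<close> on the left, so inflation goes from \<open>H\<close> to \<open>G\<close> and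
  deflation back: \<open>H\<close> is a retract of \<open>G\<close> in the biset category.\<close>

lemma bc_comp_deflation_inflation:
  assumes "ring K" "group G" "group H" "finite (carrier H)" "\<pi> \<in> epi G H"
  shows "bc_comp K H G H (kbiset K H G (deflation_biset H \<pi>)) (kbiset K G H (inflation_biset H \<pi>))
    = bc_id K H"
proof -
  have hom: "\<pi> \<in> hom G H" using assms(5) by (simp add: epi_def)
  note bisets = biset_inflation_deflation[OF assms(2-4) hom]
  show ?thesis
    unfolding bc_comp_def bc_id_def
    using kburnside_prod_kbiset[OF assms(1) bisets(2,1)]
      kbiset_eqI[OF biset_biset_prod[OF bisets(2,1)] deflation_inflation_iso[OF assms(2-5)]]
    by simp
qed

section \<open>Quotients and subquotients\<close>

lemma iso_imp_epi:
  assumes "G \<cong> H"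
  obtains h where "h \<in> epi G H"
  using assms by (auto simp: is_iso_def iso_iff_mon_epi)

lemma (in normal) r_coset_epi_Mod: "(\<lambda>a. H #> a) \<in> epi G (G Mod H)"
  using r_coset_hom_Mod by (auto simp: epi_def carrier_FactGroup)

text \<open>\<open>G\<close> is its own quotient by the trivial subgroup. This admits
  \<open>G\<close> as an object at which the functor laws can be applied.\<close>

lemma self_in_subquotients:
  assumes "group G" and "finite (carrier G)"
  shows "G \<in> subquotients G"
proof -
  interpret group G by fact
  have normal: "{\<one>\<^bsub>G\<^esub>} \<lhd> G" by (rule one_is_normal)
  have "G Mod {\<one>\<^bsub>G\<^esub>} \<cong> G"
    using trivial_factor_iso by (auto simp: is_iso_def)
  then have "G \<cong> G Mod {\<one>\<^bsub>G\<^esub>}"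
    using group.iso_sym[OF normal.factorgroup_is_group[OF normal]] by blast
  with normal show ?thesis
    unfolding subquotients_def using assms subgroup_self
    by (intro CollectI conjI exI[of _ "carrier G"] exI[of _ "{\<one>\<^bsub>G\<^esub>}"]) simp_all
qed

lemma subquotient_epi:
  assumes G: "group G"
    and quot: "\<And>B. subgroup B G \<Longrightarrow> \<exists>N. N \<lhd> G \<and> G\<lparr>carrier := B\<rparr> \<cong> G Mod N"
    and "H \<in> subquotients G"
  obtains \<pi> where "\<pi> \<in> epi G H"
proof -
  interpret group G by fact
  obtain B A where H: "group H" and B: "subgroup B G" and A: "A \<lhd> (G\<lparr>carrier := B\<rparr>)"
    and HBA: "H \<cong> (G\<lparr>carrier := B\<rparr>) Mod A"
    using assms(3) by (auto simp: subquotients_def)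
  obtain N where N: "N \<lhd> G" and BN: "G\<lparr>carrier := B\<rparr> \<cong> G Mod N"
    using quot[OF B] by blast
  obtain k where k: "k \<in> epi (G Mod N) (G\<lparr>carrier := B\<rparr>)"
    using group.iso_sym[OF subgroup.subgroup_is_group[OF B G] BN] by (rule iso_imp_epi)
  obtain h where h: "h \<in> epi ((G\<lparr>carrier := B\<rparr>) Mod A) H"
    using group.iso_sym[OF H HBA] by (rule iso_imp_epi)
  show thesis
    \<comment> \<open>The composite runs from \<open>G\<close> onto \<open>G Mod N\<close>, then to
      \<open>B\<close>, onto \<open>B\<close> modulo \<open>A\<close>, and finally to
      \<open>H\<close>.\<close>
    by (rule that, rule epi_compose[OF _ h],
        rule epi_compose[OF _ normal.r_coset_epi_Mod[OF A]],
        rule epi_compose[OF normal.r_coset_epi_Mod[OF N] k])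
qed

section \<open>Non-vanishing of simple functors at \<open>G\<close>\<close>

theorem corollary5p3:
  fixes G :: "'g monoid" and K :: "'k ring"
  assumes "group G" and "finite (carrier G)"
    and "\<And>H. subgroup H G \<Longrightarrow> \<exists>N. N \<lhd> G \<and> G\<lparr>carrier := H\<rparr> \<cong> G Mod N"
    and "field K"
  shows "NV_group TYPE('v) K G"
  unfolding NV_group_def
proof (intro allI impI notI)
  fix S :: "('k, 'g, 'v) biset_functor"
  assume simple: "simple_functor K G S" and zero: "carrier (obj_map S G) = {\<zero>\<^bsub>obj_map S G\<^esub>}"
  interpret biset_functor K G S using simple by (simp add: simple_functor_def)
  have K: "ring K" using assms(4) by (simp add: field_def domain_def cring_def)
  obtain H where H: "H \<in> subquotients G" and nz: "carrier (obj_map S H) \<noteq> {\<zero>\<^bsub>obj_map S H\<^esub>}"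
    using simple by (auto simp: simple_functor_def)
  have G: "G \<in> subquotients G" using assms by (intro self_in_subquotients)
  have "group H" "finite (carrier H)" using H by (auto simp: subquotients_def)
  obtain \<pi> where \<pi>: "\<pi> \<in> epi G H" using subquotient_epi[OF assms(1,3) H] .
  then have "\<pi> \<in> hom G H" by (simp add: epi_def)
  interpret SH: module K "obj_map S H" using obj_module[OF H] .
  define i where "i = kbiset K G H (inflation_biset H \<pi>)"
  define d where "d = kbiset K H G (deflation_biset H \<pi>)"
  have i: "i \<in> carrier (bc_hom K H G)" and d: "d \<in> carrier (bc_hom K G H)"
    using biset_inflation_deflation[OF assms(1) \<open>group H\<close> \<open>finite (carrier H)\<close> \<open>\<pi> \<in> hom G H\<close>]
    by (simp_all add: i_def d_def bc_hom_def kbiset_closed K)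
  have zero_closed: "\<zero>\<^bsub>obj_map S G\<^esub> \<in> carrier (obj_map S G)" using zero by simp
  \<comment> \<open>Writing the identity of \<open>H\<close> as deflation after inflation sends
    \<open>v\<close> through the zero module at \<open>G\<close>, so \<open>v\<close> is the image
    of zero under deflation.\<close>
  have "v = \<zero>\<^bsub>obj_map S H\<^esub>" if v: "v \<in> carrier (obj_map S H)" for v
  proof -
    have "v = mor_map S H H (bc_comp K H G H d i) v"
      using functor_id[OF H v]
        bc_comp_deflation_inflation[OF K assms(1) \<open>group H\<close> \<open>finite (carrier H)\<close> \<pi>]
      by (simp add: i_def d_def)
    also have "\<dots> = mor_map S G H d (mor_map S H G i v)"
      by (rule functor_comp[OF H G H i d v])
    also have "mor_map S H G i v = \<zero>\<^bsub>obj_map S G\<^esub>"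
      using mor_closed[OF H G i v] zero by simp
    finally have v_eq: "v = mor_map S G H d \<zero>\<^bsub>obj_map S G\<^esub>" .
    \<comment> \<open>Additivity forces zero to be mapped to zero: zero is its own double, hence so
      is its image \<open>v\<close>, and cancellation in the module at \<open>H\<close> gives the
      claim.\<close>
    have "\<zero>\<^bsub>obj_map S G\<^esub> \<oplus>\<^bsub>obj_map S G\<^esub> \<zero>\<^bsub>obj_map S G\<^esub> = \<zero>\<^bsub>obj_map S G\<^esub>"
      using module.axioms(2)[OF obj_module[OF G]] zero_closed
      by (simp add: abelian_group_def abelian_monoid.l_zero)
    then have "v \<oplus>\<^bsub>obj_map S H\<^esub> v = v"
      using mor_add[OF G H d zero_closed zero_closed] v_eq by simp
    then show ?thesis using v by simp
  qed
  then show False using nz SH.zero_closed by blast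
qed

end
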